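(* Let $b\ge1$, $m\ge1$ and $0\le n<bm$. In the exact model, for every $k\ge1$, $$\Pr(\widehat B_{m,n}=k)=\frac{k\Pr(B_{m,n}=k)}{\mathbb E\,B_{m,n}}=\frac{Q_{m,n,0}}{m^n}\,k\Pr(B_{m,n}=k).$$
   Context: Exact model: $m$ cyclically arranged buckets of capacity $b$ and $n$ labelled keys with hash addresses in the buckets, all $m^n$ hash tables equally likely; keys are placed by linear probing with wrap-around. A block is a maximal run of consecutive full buckets followed by a non-full bucket, its length being its number of buckets. $\widehat B_{m,n}$ is the length of the block containing a given bucket in a random table. $B_{m,n}$ is the length of a block chosen uniformly at random among all blocks in all $m^n$ hash tables. $Q_{m,n,0}$ is the number of hash tables with $m$ buckets and $n$ keys whose last bucket is not full. *)

theory Defs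
  imports "HOL-Probability.Probability"
begin

text \<open>Buckets are \<open>0, \<dots>, m - 1\<close> in cyclic order and keys are \<open>0, \<dots>, n - 1\<close>. A bucket is
  the list of the keys it contains, in order of arrival.\<close>

definition full :: "nat \<Rightarrow> (nat \<Rightarrow> nat list) \<Rightarrow> nat \<Rightarrow> bool" where
  "full b T i \<longleftrightarrow> length (T i) = b"

text \<open>The \<open>LEAST\<close> below is meaningful only while some bucket is not full; this is the case
  throughout the insertion of \<open>n < b * m\<close> keys.\<close>

definition insert_key ::
    "nat \<Rightarrow> nat \<Rightarrow> nat \<Rightarrow> nat \<Rightarrow> (nat \<Rightarrow> nat list) \<Rightarrow> (nat \<Rightarrow> nat list)" where
  "insert_key b m x a T =
     (let p = (a + (LEAST d. \<not> full b T ((a + d) mod m))) mod m in T(p := T p @ [x]))"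

primrec probing_table :: "nat \<Rightarrow> nat \<Rightarrow> (nat \<Rightarrow> nat) \<Rightarrow> nat \<Rightarrow> (nat \<Rightarrow> nat list)" where
  "probing_table b m h 0 = (\<lambda>_. [])"
| "probing_table b m h (Suc x) = insert_key b m x (h x) (probing_table b m h x)"

text \<open>A hash table is identified with its assignment of hash addresses to keys, so that there
  are \<open>m ^ n\<close> of them.\<close>

definition hash_tables :: "nat \<Rightarrow> nat \<Rightarrow> (nat \<Rightarrow> nat) set" where
  "hash_tables m n = {..<n} \<rightarrow>\<^sub>E {..<m}"

text \<open>A block is represented by its set of buckets: a run of \<open>r \<ge> 0\<close> full buckets starting at
  \<open>s\<close>, followed by a non-full one. The run is maximal because the bucket cyclically preceding
  \<open>s\<close> is not full either; that bucket may be the last bucket of the same block.\<close>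

definition blocks :: "nat \<Rightarrow> nat \<Rightarrow> (nat \<Rightarrow> nat list) \<Rightarrow> nat set set" where
  "blocks b m T =
     {A. \<exists>s<m. \<exists>r. A = (\<lambda>i. (s + i) mod m) ` {..r}
           \<and> (\<forall>i<r. full b T ((s + i) mod m))
           \<and> \<not> full b T ((s + r) mod m)
           \<and> \<not> full b T ((s + m - 1) mod m)}"

definition block_containing :: "nat \<Rightarrow> nat \<Rightarrow> (nat \<Rightarrow> nat list) \<Rightarrow> nat \<Rightarrow> nat set" where
  "block_containing b m T j = (THE A. A \<in> blocks b m T \<and> j \<in> A)"

definition Bhat_pmf :: "nat \<Rightarrow> nat \<Rightarrow> nat \<Rightarrow> nat \<Rightarrow> nat pmf" where
  "Bhat_pmf b m n j =
     map_pmf (\<lambda>h. card (block_containing b m (probing_table b m h n) j))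
       (pmf_of_set (hash_tables m n))"

definition B_pmf :: "nat \<Rightarrow> nat \<Rightarrow> nat \<Rightarrow> nat pmf" where
  "B_pmf b m n =
     map_pmf (\<lambda>(h, A). card A)
       (pmf_of_set (SIGMA h:hash_tables m n. blocks b m (probing_table b m h n)))"

definition Q0 :: "nat \<Rightarrow> nat \<Rightarrow> nat \<Rightarrow> nat" where
  "Q0 b m n = card {h \<in> hash_tables m n. \<not> full b (probing_table b m h n) (m - 1)}"

end

theory Submission
  imports Defs "HOL-Number_Theory.Cong"
begin

text \<open>Count triples: a table \<open>h\<close>, a block of length \<open>k\<close> of it and a bucket in that block. As the
  blocks of a table partition its buckets, there are \<open>k\<close> times as many triples as pairs of a table
  and a block of length \<open>k\<close>; by rotation symmetry, there are \<open>m\<close> times as many triples as tables in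
  which a given bucket lies in a block of length \<open>k\<close>. Since each block has exactly one non-full
  bucket, rotation symmetry also gives \<open>m * Q0 b m n\<close> as the total number of blocks.\<close>

section \<open>Key counts and the existence of a non-full bucket\<close>

lemma sum_length_fun_upd_snoc:
  fixes T :: "nat \<Rightarrow> 'a list"
  assumes "p < m"
  shows "(\<Sum>i<m. length ((T(p := T p @ [x])) i)) = Suc (\<Sum>i<m. length (T i))"
proof -
  have "(\<Sum>i<m. length ((T(p := T p @ [x])) i))
      = (\<Sum>i<m. length (T i) + (if i = p then 1 else 0))"
    by (rule sum.cong) auto
  also have "\<dots> = Suc (\<Sum>i<m. length (T i))"
    using assms by (simp add: sum.distrib)
  finally show ?thesis .
qed

text \<open>The insertion position is reduced modulo \<open>m\<close>, so each key lands in exactly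
  one of the \<open>m\<close> counted buckets, whatever value the \<open>LEAST\<close>
  takes.\<close>

lemma sum_length_probing_table:
  assumes "m > 0"
  shows "(\<Sum>i<m. length (probing_table b m h x i)) = x"
proof (induction x)
  case (Suc x)
  then show ?case
    using assms by (simp add: insert_key_def Let_def sum_length_fun_upd_snoc del: fun_upd_apply)
qed simp

text \<open>Otherwise the table would hold \<open>b * m\<close> keys. This is what makes the blocks
  cover the whole circle.\<close>

lemma ex_not_full:
  assumes "m > 0" "x < b * m"
  shows "\<exists>i<m. \<not> full b (probing_table b m h x) i"
proof (rule ccontr)
  assume "\<not> ?thesis"
  then have "(\<Sum>i<m. length (probing_table b m h x i)) = (\<Sum>i<m. b)"
    by (intro sum.cong) (auto simp: full_def)
  with assms show False
    by (simp add: sum_length_probing_table mult.commute)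
qed

section \<open>Rotation symmetry of tables and blocks\<close>

lemma add_mod_eq_iff:
  fixes i j c m :: nat
  assumes "i < m" "j < m"
  shows "(i + c) mod m = (j + c) mod m \<longleftrightarrow> i = j"
  using cong_add_rcancel_nat[of i c j m] assms by (auto simp: cong_def)

text \<open>Probing the rotated table from the rotated address meets the same pattern of full
  buckets, so both \<open>LEAST\<close> terms are literally the same and the probe lengths
  agree.\<close>

lemma insert_key_rotate:
  assumes "m > 0" and rot: "\<And>i. i < m \<Longrightarrow> T' ((i + c) mod m) = T i" and "i < m"
  shows "insert_key b m x ((a + c) mod m) T' ((i + c) mod m) = insert_key b m x a T i"
proof -
  have shift: "((a + c) mod m + d) mod m = ((a + d) mod m + c) mod m" for d
    by (simp add: mod_simps add_ac)
  have full_eq: "full b T' (((a + d) mod m + c) mod m) = full b T ((a + d) mod m)" for d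
    using rot[of "(a + d) mod m"] \<open>m > 0\<close> by (simp add: full_def)
  define p where "p = (a + (LEAST d. \<not> full b T ((a + d) mod m))) mod m"
  have "p < m" using \<open>m > 0\<close> by (simp add: p_def)
  have "insert_key b m x ((a + c) mod m) T'
      = T'((p + c) mod m := T' ((p + c) mod m) @ [x])"
    unfolding insert_key_def Let_def shift full_eq p_def by simp
  moreover have "insert_key b m x a T = T(p := T p @ [x])"
    by (simp add: insert_key_def Let_def p_def)
  ultimately show ?thesis
    using rot \<open>p < m\<close> \<open>i < m\<close> by (auto simp: add_mod_eq_iff)
qed

text \<open>The restriction to \<open>{..<n}\<close> keeps the result in the extensional function
  space \<open>hash_tables m n\<close>.\<close>

definition rotate_hash :: "nat \<Rightarrow> nat \<Rightarrow> nat \<Rightarrow> (nat \<Rightarrow> nat) \<Rightarrow> (nat \<Rightarrow> nat)" where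
  "rotate_hash m n c h = (\<lambda>x\<in>{..<n}. (h x + c) mod m)"

lemma probing_table_rotate:
  assumes "m > 0" "x \<le> n" "i < m"
  shows "probing_table b m (rotate_hash m n c h) x ((i + c) mod m) = probing_table b m h x i"
  using assms(2,3)
proof (induction x arbitrary: i)
  case (Suc x)
  then have "rotate_hash m n c h x = (h x + c) mod m"
    by (simp add: rotate_hash_def)
  with Suc \<open>m > 0\<close> show ?case
    by (simp add: insert_key_rotate)
qed simp

lemma full_rotate:
  assumes "m > 0"
  shows "full b (probing_table b m (rotate_hash m n c h) n) ((i + c) mod m)
     = full b (probing_table b m h n) (i mod m)"
proof -
  have "(i + c) mod m = (i mod m + c) mod m"
    by (simp add: mod_simps)
  with probing_table_rotate[OF assms order_refl, of "i mod m"] assms show ?thesis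
    by (simp add: full_def)
qed

lemma finite_hash_tables: "finite (hash_tables m n)"
  by (simp add: hash_tables_def finite_PiE)

lemma card_hash_tables: "card (hash_tables m n) = m ^ n"
  by (simp add: hash_tables_def card_PiE)

lemma rotate_hash_in:
  assumes "m > 0"
  shows "rotate_hash m n c h \<in> hash_tables m n"
  using assms by (auto simp: rotate_hash_def hash_tables_def)

lemma inj_on_rotate_hash: "inj_on (rotate_hash m n c) (hash_tables m n)"
proof (rule inj_onI)
  fix h h'
  assume h: "h \<in> hash_tables m n" "h' \<in> hash_tables m n"
    and eq: "rotate_hash m n c h = rotate_hash m n c h'"
  show "h = h'"
  proof (rule PiE_ext[of _ "{..<n}" "\<lambda>_. {..<m}"])
    fix x assume x: "x \<in> {..<n}"
    with fun_cong[OF eq, of x] have "(h x + c) mod m = (h' x + c) mod m"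
      by (simp add: rotate_hash_def)
    moreover have "h x < m" "h' x < m"
      using h x by (auto simp: hash_tables_def PiE_iff)
    ultimately show "h x = h' x" by (simp add: add_mod_eq_iff)
  qed (use h in \<open>simp_all add: hash_tables_def\<close>)
qed

text \<open>A suitable rotation maps the tables with \<open>P\<close> at \<open>i\<close>
  injectively into those with \<open>P\<close> at \<open>j\<close>. Exchanging \<open>i\<close> and
  \<open>j\<close> gives the reverse inequality, so invariance of \<open>P\<close> in one direction
  suffices.\<close>

lemma card_rotation_invariant:
  assumes "i < m" "j < m"
    and rot: "\<And>h i c. h \<in> hash_tables m n \<Longrightarrow> i < m \<Longrightarrow> P h i
      \<Longrightarrow> P (rotate_hash m n c h) ((i + c) mod m)"
  shows "card {h \<in> hash_tables m n. P h i} = card {h \<in> hash_tables m n. P h j}"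
proof -
  have le: "card {h \<in> hash_tables m n. P h i} \<le> card {h \<in> hash_tables m n. P h j}"
    if "i < m" "j < m" for i j
  proof -
    \<comment> \<open>This is j - i modulo \<open>m\<close>, written without truncated
      subtraction.\<close>
    define c where "c = j + (m - i)"
    have "(i + c) mod m = j"
      using that by (simp add: c_def)
    then have "rotate_hash m n c ` {h \<in> hash_tables m n. P h i} \<subseteq> {h \<in> hash_tables m n. P h j}"
      using rot[of _ i c] that by (auto intro: rotate_hash_in)
    moreover have "inj_on (rotate_hash m n c) {h \<in> hash_tables m n. P h i}"
      by (rule inj_on_subset[OF inj_on_rotate_hash]) auto
    ultimately show ?thesis
      by (intro card_inj_on_le) (auto simp: finite_hash_tables)
  qed
  show ?thesis
    using le assms(1,2) by (intro antisym)
qed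

lemma block_rotate:
  assumes "m > 0" and A: "A \<in> blocks b m (probing_table b m h n)"
  shows "(\<lambda>i. (i + c) mod m) ` A \<in> blocks b m (probing_table b m (rotate_hash m n c h) n)"
proof -
  let ?T' = "probing_table b m (rotate_hash m n c h) n"
  obtain s r where sr: "s < m" "A = (\<lambda>i. (s + i) mod m) ` {..r}"
    "\<And>i. i < r \<Longrightarrow> full b (probing_table b m h n) ((s + i) mod m)"
    "\<not> full b (probing_table b m h n) ((s + r) mod m)"
    "\<not> full b (probing_table b m h n) ((s + m - 1) mod m)"
    using A unfolding blocks_def by blast
  define s' where "s' = (s + c) mod m"
  have shift: "(s' + i) mod m = (s + i + c) mod m" for i
    by (simp add: s'_def mod_simps add_ac)
  \<comment> \<open>The bucket preceding the start is the one at offset \<open>m - 1\<close> from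
    it, so it rotates like the others.\<close>
  have last: "(s' + m - 1) mod m = ((s + m - 1) + c) mod m"
    using shift[of "m - 1"] \<open>m > 0\<close> by simp
  have "(\<lambda>i. (i + c) mod m) ` A = (\<lambda>i. (s' + i) mod m) ` {..r}"
    by (simp add: sr(2) image_image shift mod_simps)
  moreover have "s' < m" using \<open>m > 0\<close> by (simp add: s'_def)
  moreover have "\<forall>i<r. full b ?T' ((s' + i) mod m)" "\<not> full b ?T' ((s' + r) mod m)"
    using sr(3,4) \<open>m > 0\<close> by (simp_all add: shift full_rotate)
  moreover have "\<not> full b ?T' ((s' + m - 1) mod m)"
    unfolding last full_rotate[OF \<open>m > 0\<close>] by (rule sr(5))
  ultimately show ?thesis
    unfolding blocks_def by blast
qed

section \<open>Existence and uniqueness of the block of a bucket\<close>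

lemma block_subset:
  assumes "A \<in> blocks b m T"
  shows "A \<subseteq> {..<m}"
  using assms by (auto simp: blocks_def)

lemma block_exists:
  assumes "j < m" and nonfull: "\<exists>i<m. \<not> full b T i"
  shows "\<exists>A\<in>blocks b m T. j \<in> A"
proof -
  define S where "S = {t. t < m \<and> \<not> full b T ((j + t) mod m)}"
  obtain i where i: "i < m" "\<not> full b T i" using nonfull by blast
  \<comment> \<open>The offset of the non-full bucket \<open>i\<close> counted forward from
    \<open>j\<close>.\<close>
  have "(j + (i + (m - j)) mod m) mod m = (j + (i + (m - j))) mod m"
    by (simp add: mod_simps)
  also have "\<dots> = i" using i(1) \<open>j < m\<close> by simp
  finally have "(i + (m - j)) mod m \<in> S"
    using i by (simp add: S_def)
  then have "S \<noteq> {}" by blast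
  have "finite S" by (simp add: S_def)
  \<comment> \<open>Offset \<open>d\<close> is the first non-full bucket met from \<open>j\<close>
    onward and ends the block. Offset \<open>t\<close> is the last one met in a full turn, hence the
    one just before the block; if \<open>j\<close> alone is non-full, both are 0 and the block is
    the whole circle.\<close>
  define t d where "t = Max S" and "d = Min S"
  have t: "t < m" "\<not> full b T ((j + t) mod m)" and d: "d < m" "\<not> full b T ((j + d) mod m)"
    using Max_in[OF \<open>finite S\<close> \<open>S \<noteq> {}\<close>] Min_in[OF \<open>finite S\<close> \<open>S \<noteq> {}\<close>]
    by (auto simp: S_def t_def d_def)
  have after_t: "full b T ((j + u) mod m)" if "t < u" "u < m" for u
  proof -
    have "u \<notin> S" using that Max_ge[OF \<open>finite S\<close>, of u] by (auto simp: t_def)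
    then show ?thesis using that by (simp add: S_def)
  qed
  have before_d: "full b T ((j + u) mod m)" if "u < d" for u
  proof -
    have "u \<notin> S" using that Min_le[OF \<open>finite S\<close>, of u] by (auto simp: d_def)
    then show ?thesis using that d by (simp add: S_def)
  qed
  \<comment> \<open>The run starts right after offset \<open>t\<close>: \<open>m - 1 - t\<close>
    full buckets lead around to \<open>j\<close>, and \<open>d\<close> more to the non-full
    end.\<close>
  define s r where "s = (j + t + 1) mod m" and "r = (m - 1 - t) + d"
  have shift: "(s + u) mod m = (j + (t + 1 + u)) mod m" for u
    by (simp add: s_def mod_simps add_ac)
  have wrap: "(s + (m - 1 - t + u)) mod m = (j + u) mod m" for u
  proof -
    have "j + (t + 1 + (m - 1 - t + u)) = j + u + m" using \<open>t < m\<close> by simp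
    then show ?thesis by (simp only: shift mod_add_self2)
  qed
  have "s < m" using \<open>j < m\<close> by (simp add: s_def)
  moreover have "full b T ((s + i) mod m)" if "i < r" for i
  proof (cases "i < m - 1 - t")
    case True
    then show ?thesis using after_t[of "t + 1 + i"] by (simp add: shift)
  next
    case False
    then have "i = m - 1 - t + (i - (m - 1 - t))" by simp
    moreover have "i - (m - 1 - t) < d" using False that by (simp add: r_def)
    ultimately show ?thesis using wrap before_d by metis
  qed
  moreover have "\<not> full b T ((s + r) mod m)"
    using wrap[of d] d(2) by (simp add: r_def)
  moreover have "\<not> full b T ((s + m - 1) mod m)"
    using wrap[of t] t by simp
  ultimately have "(\<lambda>i. (s + i) mod m) ` {..r} \<in> blocks b m T"
    unfolding blocks_def by blast
  moreover have "j \<in> (\<lambda>i. (s + i) mod m) ` {..r}"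
    using wrap[of 0] \<open>j < m\<close> by (intro image_eqI[of _ _ "m - 1 - t"]) (auto simp: r_def)
  ultimately show ?thesis by (rule bexI[rotated])
qed

text \<open>If two runs meet, then the one whose start is nearer to the common bucket cannot start later
  than the other one, since its preceding bucket would be a full bucket of the other run.\<close>

lemma run_start_le:
  fixes s s' i i' m :: nat
  assumes "m > 0" "(s + i) mod m = (s' + i') mod m" "i' \<le> r'"
    and full: "\<And>u. u < r' \<Longrightarrow> F ((s' + u) mod m)" and nonfull: "\<not> F ((s + m - 1) mod m)"
  shows "i' \<le> i"
proof (rule ccontr)
  assume "\<not> i' \<le> i"
  then have less: "i < i'" by simp
  \<comment> \<open>To stay clear of subtraction, \<open>i + 1\<close> is added on both sides and
    then cancelled modulo \<open>m\<close>.\<close>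
  have "s + m - 1 + (i + 1) = s + i + m"
    using \<open>m > 0\<close> by simp
  then have "[s + m - 1 + (i + 1) = s + i] (mod m)"
    by (simp only: cong_def mod_add_self2)
  also have "[s + i = s' + i'] (mod m)" using assms(2) by (simp add: cong_def)
  also have "s' + i' = s' + (i' - i - 1) + (i + 1)" using less by simp
  finally have "(s + m - 1) mod m = (s' + (i' - i - 1)) mod m"
    unfolding cong_add_rcancel_nat by (simp add: cong_def)
  moreover have "i' - i - 1 < r'" using less \<open>i' \<le> r'\<close> by simp
  ultimately show False using full nonfull by metis
qed

text \<open>If the second run reached further beyond the common bucket, the non-full end of the
  first would be one of its full buckets.\<close>

lemma run_end_le:
  fixes s s' i i' m :: nat
  assumes "(s + i) mod m = (s' + i') mod m" "i \<le> r" "i' \<le> r'"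
    and full: "\<And>u. u < r' \<Longrightarrow> F ((s' + u) mod m)" and nonfull: "\<not> F ((s + r) mod m)"
  shows "r' - i' \<le> r - i"
proof (rule ccontr)
  assume less: "\<not> ?thesis"
  have "(s + r) mod m = ((s + i) mod m + (r - i)) mod m"
    using \<open>i \<le> r\<close> by (simp only: mod_add_left_eq) simp
  also have "\<dots> = (s' + (i' + (r - i))) mod m"
    unfolding assms(1) by (simp add: mod_simps add_ac)
  finally show False using less full[of "i' + (r - i)"] nonfull by simp
qed

text \<open>Applying \<open>run_start_le\<close> and \<open>run_end_le\<close> in both directions
  shows that \<open>j\<close> has the same distance to the start and to the end of both
  blocks.\<close>

lemma block_unique:
  assumes A: "A \<in> blocks b m T" "j \<in> A" and A': "A' \<in> blocks b m T" "j \<in> A'"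
  shows "A = A'"
proof -
  obtain s r where sr: "s < m" "A = (\<lambda>i. (s + i) mod m) ` {..r}"
    "\<And>i. i < r \<Longrightarrow> full b T ((s + i) mod m)"
    "\<not> full b T ((s + r) mod m)" "\<not> full b T ((s + m - 1) mod m)"
    using A(1) unfolding blocks_def by blast
  obtain s' r' where sr': "s' < m" "A' = (\<lambda>i. (s' + i) mod m) ` {..r'}"
    "\<And>i. i < r' \<Longrightarrow> full b T ((s' + i) mod m)"
    "\<not> full b T ((s' + r') mod m)" "\<not> full b T ((s' + m - 1) mod m)"
    using A'(1) unfolding blocks_def by blast
  obtain i i' where i: "i \<le> r" "i' \<le> r'" and eq: "(s + i) mod m = (s' + i') mod m"
    using A(2) A'(2) sr(2) sr'(2) by auto
  have "m > 0" using sr(1) by simp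
  have "i = i'"
    using run_start_le[OF \<open>m > 0\<close> eq i(2), of "full b T"]
      run_start_le[OF \<open>m > 0\<close> eq[symmetric] i(1), of "full b T"] sr sr'
    by fastforce
  moreover have "r - i = r' - i'"
    using run_end_le[OF eq i, of "full b T"]
      run_end_le[OF eq[symmetric] i(2) i(1), of "full b T"] sr sr'
    by fastforce
  ultimately have "r = r'" "s = s'"
    using i eq sr(1) sr'(1) by (auto simp: add_mod_eq_iff)
  then show ?thesis using sr(2) sr'(2) by simp
qed

section \<open>Counting over the blocks of one table\<close>

lemma Union_blocks:
  assumes "\<exists>i<m. \<not> full b T i"
  shows "\<Union>(blocks b m T) = {..<m}"
  using block_subset block_exists[OF _ assms] by fastforce

lemma finite_blocks: "finite (blocks b m T)"
  by (rule finite_subset[of _ "Pow {..<m}"]) (auto dest: block_subset)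

text \<open>Distinct blocks are disjoint by \<open>block_unique\<close>. The set \<open>X\<close>
  will be the non-full buckets when blocks are counted, and \<open>UNIV\<close> when lengths are
  added.\<close>

lemma sum_card_block_Int:
  assumes "\<exists>i<m. \<not> full b T i" "\<B> \<subseteq> blocks b m T"
  shows "(\<Sum>A\<in>\<B>. card (A \<inter> X)) = card (\<Union>\<B> \<inter> X)"
proof -
  have "card (\<Union>A\<in>\<B>. A \<inter> X) = (\<Sum>A\<in>\<B>. card (A \<inter> X))"
  proof (rule card_UN_disjoint)
    show "finite \<B>" using assms(2) finite_blocks finite_subset by blast
    have "finite A" if "A \<in> \<B>" for A
      using that assms(2) finite_subset[OF block_subset finite_lessThan] by auto
    then show "\<forall>A\<in>\<B>. finite (A \<inter> X)" by simp
    have "A = A'" if "A \<in> \<B>" "A' \<in> \<B>" "i \<in> A" "i \<in> A'" for A A' i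
      using that assms(2) by (intro block_unique[of A b m T i A']) auto
    then show "\<forall>A\<in>\<B>. \<forall>A'\<in>\<B>. A \<noteq> A' \<longrightarrow> (A \<inter> X) \<inter> (A' \<inter> X) = {}"
      by (auto 4 3)
  qed
  also have "(\<Union>A\<in>\<B>. A \<inter> X) = \<Union>\<B> \<inter> X" by blast
  finally show ?thesis by simp
qed

lemma card_block_Int_nonfull:
  assumes "A \<in> blocks b m T"
  shows "card (A \<inter> {i. \<not> full b T i}) = 1"
proof -
  obtain s r where sr: "A = (\<lambda>i. (s + i) mod m) ` {..r}"
    "\<And>i. i < r \<Longrightarrow> full b T ((s + i) mod m)" "\<not> full b T ((s + r) mod m)"
    using assms unfolding blocks_def by blast
  have "A \<inter> {i. \<not> full b T i} = {(s + r) mod m}"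
    using sr by (auto simp: le_less)
  then show ?thesis by simp
qed

lemma card_blocks:
  assumes "\<exists>i<m. \<not> full b T i"
  shows "card (blocks b m T) = card {i. i < m \<and> \<not> full b T i}"
proof -
  have "card (blocks b m T) = (\<Sum>A\<in>blocks b m T. card (A \<inter> {i. \<not> full b T i}))"
    by (simp add: card_block_Int_nonfull)
  also have "\<dots> = card (\<Union>(blocks b m T) \<inter> {i. \<not> full b T i})"
    by (rule sum_card_block_Int[OF assms order_refl])
  also have "\<Union>(blocks b m T) \<inter> {i. \<not> full b T i} = {i. i < m \<and> \<not> full b T i}"
    using Union_blocks[OF assms] by auto
  finally show ?thesis .
qed

text \<open>Replaces the \<open>THE\<close> by an existential statement, to which rotation and
  double counting apply.\<close>

lemma card_block_containing_eq_iff: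
  assumes "\<exists>i<m. \<not> full b T i" "j < m"
  shows "card (block_containing b m T j) = k \<longleftrightarrow> (\<exists>A\<in>blocks b m T. j \<in> A \<and> card A = k)"
proof -
  obtain A where A: "A \<in> blocks b m T" "j \<in> A"
    using block_exists assms by blast
  then have "block_containing b m T j = A"
    unfolding block_containing_def using block_unique by (intro the_equality) blast+
  then show ?thesis using A block_unique by blast
qed

section \<open>Double counting over all tables\<close>

lemma sum_card_swap:
  assumes "finite A" "finite B"
  shows "(\<Sum>x\<in>A. card {y \<in> B. P x y}) = (\<Sum>y\<in>B. card {x \<in> A. P x y})"
  using sum.swap_restrict[OF assms, of "\<lambda>_ _. 1::nat" P] by simp

text \<open>The sample space on which \<open>B_pmf\<close> draws uniformly.\<close>

definition table_blocks :: "nat \<Rightarrow> nat \<Rightarrow> nat \<Rightarrow> ((nat \<Rightarrow> nat) \<times> nat set) set" where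
  "table_blocks b m n = (SIGMA h:hash_tables m n. blocks b m (probing_table b m h n))"

lemma finite_table_blocks: "finite (table_blocks b m n)"
  by (simp add: table_blocks_def finite_hash_tables finite_blocks)

lemma card_table_blocks:
  assumes "m > 0" "n < b * m"
  shows "card (table_blocks b m n) = m * Q0 b m n"
proof -
  let ?P = "\<lambda>h i. \<not> full b (probing_table b m h n) i"
  have "card (table_blocks b m n) = (\<Sum>h\<in>hash_tables m n. card {i \<in> {..<m}. ?P h i})"
    unfolding table_blocks_def using ex_not_full[OF assms]
    by (simp add: card_SigmaI finite_hash_tables finite_blocks card_blocks)
  also have "\<dots> = (\<Sum>i<m. card {h \<in> hash_tables m n. ?P h i})"
    by (rule sum_card_swap) (simp_all add: finite_hash_tables)
  \<comment> \<open>By rotation, each bucket \<open>i\<close> is non-full in as many tables as the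
    last bucket \<open>m - 1\<close>.\<close>
  also have "\<dots> = (\<Sum>i<m. Q0 b m n)"
    unfolding Q0_def
    by (intro sum.cong refl card_rotation_invariant) (use assms in \<open>auto simp: full_rotate\<close>)
  finally show ?thesis by simp
qed

lemma card_tables_block_containing:
  assumes "m > 0" "n < b * m" "j < m"
  shows "m * card {h \<in> hash_tables m n. card (block_containing b m (probing_table b m h n) j) = k}
    = k * card {(h, A) \<in> table_blocks b m n. card A = k}"
proof -
  let ?T = "\<lambda>h. probing_table b m h n"
  let ?P = "\<lambda>h i. \<exists>A\<in>blocks b m (?T h). i \<in> A \<and> card A = k"
  let ?B = "\<lambda>h. {A \<in> blocks b m (?T h). card A = k}"
  note nonfull = ex_not_full[OF assms(1,2)]
  \<comment> \<open>Rotation is injective on buckets below \<open>m\<close>, so a rotated block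
    keeps its length.\<close>
  have rot: "?P (rotate_hash m n c h) ((i + c) mod m)" if P: "?P h i" for h i c
  proof -
    obtain A where A: "A \<in> blocks b m (?T h)" "i \<in> A" "card A = k" using P by blast
    have "inj_on (\<lambda>i. (i + c) mod m) A"
      using block_subset[OF A(1)] by (auto simp: inj_on_def add_mod_eq_iff subset_eq)
    then show ?thesis
      using A block_rotate[OF \<open>m > 0\<close> A(1), of c]
      by (intro bexI[of _ "(\<lambda>i. (i + c) mod m) ` A"]) (auto simp: card_image)
  qed
  have "m * card {h \<in> hash_tables m n. card (block_containing b m (?T h) j) = k}
      = (\<Sum>i<m. card {h \<in> hash_tables m n. ?P h j})"
    by (simp add: card_block_containing_eq_iff[OF nonfull assms(3)])
  also have "\<dots> = (\<Sum>i<m. card {h \<in> hash_tables m n. ?P h i})"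
    by (intro sum.cong refl card_rotation_invariant rot) (use assms in auto)
  also have "\<dots> = (\<Sum>h\<in>hash_tables m n. card {i \<in> {..<m}. ?P h i})"
    by (rule sum_card_swap) (simp_all add: finite_hash_tables)
  also have "\<dots> = (\<Sum>h\<in>hash_tables m n. k * card (?B h))"
  proof (rule sum.cong[OF refl])
    fix h
    \<comment> \<open>The buckets in blocks of length \<open>k\<close> form the disjoint union of
      these blocks, each contributing \<open>k\<close>.\<close>
    have "{i \<in> {..<m}. ?P h i} = \<Union>(?B h) \<inter> UNIV"
      using block_subset by fastforce
    then have "card {i \<in> {..<m}. ?P h i} = (\<Sum>A\<in>?B h. card (A \<inter> UNIV))"
      using sum_card_block_Int[OF nonfull[of h], of "?B h" UNIV] by simp
    then show "card {i \<in> {..<m}. ?P h i} = k * card (?B h)" by simp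
  qed
  also have "\<dots> = k * card (SIGMA h:hash_tables m n. ?B h)"
    by (simp add: sum_distrib_left card_SigmaI finite_hash_tables finite_blocks)
  also have "(SIGMA h:hash_tables m n. ?B h) = {(h, A) \<in> table_blocks b m n. card A = k}"
    by (auto simp: table_blocks_def)
  finally show ?thesis .
qed

text \<open>In every table the block lengths add up to \<open>m\<close>. The total is the numerator
  of the mean block length.\<close>

lemma sum_card_table_blocks:
  assumes "m > 0" "n < b * m"
  shows "(\<Sum>(h, A)\<in>table_blocks b m n. card A) = m * m ^ n"
proof -
  note nonfull = ex_not_full[OF assms]
  have "(\<Sum>A\<in>blocks b m (probing_table b m h n). card A) = m" for h
    using sum_card_block_Int[OF nonfull order_refl, where X = UNIV]
      Union_blocks[OF nonfull]
    by (metis Int_UNIV_right card_lessThan sum.cong)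
  then show ?thesis
    unfolding table_blocks_def
    by (simp add: sum.Sigma[symmetric] finite_hash_tables finite_blocks card_hash_tables)
qed

section \<open>Passage from counts to probabilities\<close>

theorem theorem10p11:
  fixes b m n j k :: nat
  assumes "b \<ge> 1" and "m \<ge> 1" and "n < b * m" and "j < m" and "k \<ge> 1"
  shows "pmf (Bhat_pmf b m n j) k
           = real k * pmf (B_pmf b m n) k / measure_pmf.expectation (B_pmf b m n) real
       \<and> real k * pmf (B_pmf b m n) k / measure_pmf.expectation (B_pmf b m n) real
           = real (Q0 b m n) / real m ^ n * (real k * pmf (B_pmf b m n) k)"
proof -
  have "m > 0" using assms(2) by simp
  define S where "S = table_blocks b m n"
  define N where "N = card {(h, A) \<in> S. card A = k}"
  define H where
    "H = card {h \<in> hash_tables m n. card (block_containing b m (probing_table b m h n) j) = k}"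
  have "finite S" by (simp add: S_def finite_table_blocks)
  have cardS: "card S = m * Q0 b m n"
    unfolding S_def by (rule card_table_blocks[OF \<open>m > 0\<close> assms(3)])
  have sumS: "(\<Sum>(h, A)\<in>S. card A) = m * m ^ n"
    unfolding S_def by (rule sum_card_table_blocks[OF \<open>m > 0\<close> assms(3)])
  \<comment> \<open>An empty \<open>S\<close> would make the total length 0, but it is positive.
    Nonemptiness is required for \<open>pmf_of_set S\<close> to be the uniform distribution, and it
    gives \<open>Q0 b m n > 0\<close>.\<close>
  then have "S \<noteq> {}" using \<open>m > 0\<close> by auto
  then have "Q0 b m n > 0" using cardS \<open>finite S\<close> by (metis card_gt_0_iff nat_0_less_mult_iff)
  have HN: "m * H = k * N"
    unfolding H_def N_def S_def by (rule card_tables_block_containing[OF \<open>m > 0\<close> assms(3,4)])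
  have "hash_tables m n \<noteq> {}"
    using card_hash_tables[of m n] \<open>m > 0\<close> by auto
  then have Bhat: "pmf (Bhat_pmf b m n j) k = real H / real m ^ n"
    by (simp add: Bhat_pmf_def pmf_map measure_pmf_of_set finite_hash_tables card_hash_tables
        H_def vimage_def Int_def)
  have H: "real H = real k * real N / real m"
    using arg_cong[OF HN, of real] \<open>m > 0\<close> by (simp add: field_simps)
  have B: "B_pmf b m n = map_pmf (\<lambda>(h, A). card A) (pmf_of_set S)"
    by (simp add: B_pmf_def S_def table_blocks_def)
  have "S \<inter> (\<lambda>(h, A). card A) -` {k} = {(h, A) \<in> S. card A = k}" by auto
  then have pmf_B: "pmf (B_pmf b m n) k = real N / (real m * real (Q0 b m n))"
    by (simp add: B pmf_map measure_pmf_of_set \<open>finite S\<close> \<open>S \<noteq> {}\<close> cardS N_def)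
  have expectation_B: "measure_pmf.expectation (B_pmf b m n) real = real m ^ n / real (Q0 b m n)"
  proof -
    have "measure_pmf.expectation (B_pmf b m n) real
        = real (\<Sum>(h, A)\<in>S. card A) / real (card S)"
      by (simp add: B integral_pmf_of_set \<open>finite S\<close> \<open>S \<noteq> {}\<close> case_prod_unfold)
    then show ?thesis using \<open>m > 0\<close> by (simp add: sumS cardS)
  qed
  \<comment> \<open>After substitution all three expressions equal
    \<open>k * N / (m * m ^ n)\<close>, the factor \<open>Q0 b m n\<close> cancelling.\<close>
  show ?thesis
    unfolding Bhat H pmf_B expectation_B
    using \<open>m > 0\<close> \<open>Q0 b m n > 0\<close> by (simp add: field_simps)
qed

end
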